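(* Let $(X,\mathcal{A})$ be a measurable space whose $\sigma$-algebra $\mathcal{A}$ is infinite. Then $\mathcal{M}^*(X,\mathcal{A})$ contains a copy of $\ell^\infty$ as a closed subspace; that is, $\mathcal{M}^*(X,\mathcal{A})$ has a closed linear subspace that is isomorphic (linearly homeomorphic) to $\ell^\infty$.
   Context: A measurable space $(X,\mathcal{A})$ is a nonempty set $X$ with a $\sigma$-algebra $\mathcal{A}$ of subsets of $X$. $\mathcal{M}^*(X,\mathcal{A})$ is the real Banach space of all bounded $\mathcal{A}$-measurable functions $f:X\to\mathbb{R}$ with the supremum norm. $\ell^\infty$ is the Banach space of all bounded sequences of real numbers with the supremum norm. *)

theory Defs
  imports "HOL-Analysis.Analysis" "HOL-Library.Function_Algebras"
begin

text \<open>Pointwise scalar multiplication; addition, zero and subtraction of functions are those of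
  \<^theory>\<open>HOL-Library.Function_Algebras\<close>.\<close>

instantiation "fun" :: (type, real_vector) real_vector
begin

definition scaleR_fun :: "real \<Rightarrow> ('a \<Rightarrow> 'b) \<Rightarrow> 'a \<Rightarrow> 'b" where
  "scaleR_fun c f = (\<lambda>x. c *\<^sub>R f x)"

instance
  by standard (simp_all add: scaleR_fun_def fun_eq_iff algebra_simps)

end

definition sup_norm :: "'a set \<Rightarrow> ('a \<Rightarrow> real) \<Rightarrow> real" where
  "sup_norm X f = (SUP x\<in>X. \<bar>f x\<bar>)"

text \<open>The value \<open>0\<close> when \<open>f - g\<close> is unbounded is never used for two bounded functions. It is there
  because \<^locale>\<open>Metric_space\<close> asks for a nonnegative distance outside the carrier too.\<close>

definition sup_dist :: "'a set \<Rightarrow> ('a \<Rightarrow> real) \<Rightarrow> ('a \<Rightarrow> real) \<Rightarrow> real" where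
  "sup_dist X f g = (if bounded ((f - g) ` X) then sup_norm X (f - g) else 0)"

text \<open>A function on \<open>X\<close> is represented by its extension by \<open>0\<close> to the whole type, so that pointwise
  operations on the type are the operations of functions on \<open>X\<close>. The measure of \<open>sigma X \<A>\<close>
  (which is zero) plays no role; if \<open>\<A>\<close> is a \<open>\<sigma>\<close>-algebra on \<open>X\<close> then its measurable sets are
  exactly those in \<open>\<A>\<close>.\<close>

definition bounded_measurable :: "'a set \<Rightarrow> 'a set set \<Rightarrow> ('a \<Rightarrow> real) set" where
  "bounded_measurable X \<A> =
     {f. f \<in> borel_measurable (sigma X \<A>) \<and> bounded (f ` X) \<and> (\<forall>x. x \<notin> X \<longrightarrow> f x = 0)}"

definition bounded_measurable_topology :: "'a set \<Rightarrow> 'a set set \<Rightarrow> ('a \<Rightarrow> real) topology" where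
  "bounded_measurable_topology X \<A> = Metric_space.mtopology (bounded_measurable X \<A>) (sup_dist X)"

definition linfty :: "(nat \<Rightarrow> real) set" where
  "linfty = {x. bounded (range x)}"

definition linfty_topology :: "(nat \<Rightarrow> real) topology" where
  "linfty_topology = Metric_space.mtopology linfty (sup_dist UNIV)"

definition linear_map_on :: "'v::real_vector set \<Rightarrow> ('v \<Rightarrow> 'w::real_vector) \<Rightarrow> bool" where
  "linear_map_on V T \<longleftrightarrow>
     (\<forall>u\<in>V. \<forall>v\<in>V. T (u + v) = T u + T v) \<and> (\<forall>c. \<forall>v\<in>V. T (c *\<^sub>R v) = c *\<^sub>R T v)"

lemma bounded_image_add:
  fixes f g :: "'a \<Rightarrow> real"
  assumes "bounded (f ` X)" "bounded (g ` X)"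
  shows "bounded ((f + g) ` X)"
  using bounded_plus_comp[OF assms] by (simp add: plus_fun_def)

lemma bounded_image_diff:
  fixes f g :: "'a \<Rightarrow> real"
  assumes "bounded (f ` X)" "bounded (g ` X)"
  shows "bounded ((f - g) ` X)"
  using bounded_minus_comp[OF assms] by (simp add: fun_diff_def)

lemma bounded_image_scaleR:
  fixes f :: "'a \<Rightarrow> real"
  assumes "bounded (f ` X)"
  shows "bounded ((c *\<^sub>R f) ` X)"
  using bounded_scaling[OF assms, of c] by (simp add: image_image scaleR_fun_def)

lemma abs_le_sup_norm:
  assumes "bounded (f ` X)" "x \<in> X"
  shows "\<bar>f x\<bar> \<le> sup_norm X f"
proof -
  obtain B where "\<And>x. x \<in> X \<Longrightarrow> \<bar>f x\<bar> \<le> B"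
    using assms(1) by (auto simp: bounded_iff)
  then have "bdd_above ((\<lambda>x. \<bar>f x\<bar>) ` X)"
    by (auto intro!: bdd_aboveI)
  then show ?thesis
    unfolding sup_norm_def using assms(2) by (rule cSUP_upper2) simp
qed

lemma Metric_space_sup_dist:
  assumes X: "X \<noteq> {}"
    and bdd: "\<And>f. f \<in> V \<Longrightarrow> bounded (f ` X)"
    and zero: "\<And>f x. f \<in> V \<Longrightarrow> x \<notin> X \<Longrightarrow> f x = 0"
  shows "Metric_space V (sup_dist X)"
proof
  fix f g :: "'a \<Rightarrow> real"
  obtain x where x: "x \<in> X" using X by blast
  show "0 \<le> sup_dist X f g"
    using abs_le_sup_norm[OF _ x, of "f - g"] by (auto simp: sup_dist_def)
  have "(g - f) ` X = uminus ` ((f - g) ` X)"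
    by (auto simp: image_image)
  then have "bounded ((f - g) ` X) \<longleftrightarrow> bounded ((g - f) ` X)"
    by (metis bounded_uminus)
  then show "sup_dist X f g = sup_dist X g f"
    by (simp add: sup_dist_def sup_norm_def abs_minus_commute)
next
  fix f g assume fg: "f \<in> V" "g \<in> V"
  have b: "bounded ((f - g) ` X)" using bounded_image_diff bdd fg by blast
  show "sup_dist X f g = 0 \<longleftrightarrow> f = g"
  proof
    assume "sup_dist X f g = 0"
    then have "\<And>x. x \<in> X \<Longrightarrow> f x = g x"
      using abs_le_sup_norm[OF b] b by (fastforce simp: sup_dist_def)
    then show "f = g" using zero fg by (metis ext)
  next
    assume "f = g"
    then show "sup_dist X f g = 0" using X by (simp add: sup_dist_def sup_norm_def)
  qed
next
  fix f g h assume V: "f \<in> V" "g \<in> V" "h \<in> V"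
  have b: "bounded ((f - g) ` X)" "bounded ((g - h) ` X)" "bounded ((f - h) ` X)"
    using bounded_image_diff bdd V by blast+
  have "sup_norm X (f - h) \<le> sup_norm X (f - g) + sup_norm X (g - h)"
    unfolding sup_norm_def[of X "f - h"]
  proof (rule cSUP_least[OF X])
    fix x assume "x \<in> X"
    then show "\<bar>(f - h) x\<bar> \<le> sup_norm X (f - g) + sup_norm X (g - h)"
      using abs_le_sup_norm[OF b(1), of x] abs_le_sup_norm[OF b(2), of x] by simp
  qed
  then show "sup_dist X f h \<le> sup_dist X f g + sup_dist X g h"
    using b by (simp add: sup_dist_def)
qed

lemma Metric_space_bounded_measurable:
  "X \<noteq> {} \<Longrightarrow> Metric_space (bounded_measurable X \<A>) (sup_dist X)"
  by (rule Metric_space_sup_dist) (auto simp: bounded_measurable_def)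

lemma Metric_space_linfty: "Metric_space linfty (sup_dist UNIV)"
  by (rule Metric_space_sup_dist) (auto simp: linfty_def)

lemma topspace_bounded_measurable_topology:
  "X \<noteq> {} \<Longrightarrow> topspace (bounded_measurable_topology X \<A>) = bounded_measurable X \<A>"
  by (simp add: bounded_measurable_topology_def Metric_space.topspace_mtopology
      Metric_space_bounded_measurable)

lemma topspace_linfty_topology: "topspace linfty_topology = linfty"
  by (simp add: linfty_topology_def Metric_space.topspace_mtopology Metric_space_linfty)

lemma subspace_bounded_measurable: "subspace (bounded_measurable X \<A>)"
proof (rule subspaceI)
  show "0 \<in> bounded_measurable X \<A>"
    by (auto simp: bounded_measurable_def zero_fun_def bounded_iff)
next
  fix f g assume "f \<in> bounded_measurable X \<A>" "g \<in> bounded_measurable X \<A>"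
  then show "f + g \<in> bounded_measurable X \<A>"
    using bounded_image_add[of f X g] borel_measurable_add[of f "sigma X \<A>" g]
    by (auto simp: bounded_measurable_def plus_fun_def)
next
  fix c f assume "f \<in> bounded_measurable X \<A>"
  then show "c *\<^sub>R f \<in> bounded_measurable X \<A>"
    using bounded_image_scaleR[of f X c]
    by (auto simp: bounded_measurable_def scaleR_fun_def)
qed

lemma subspace_linfty: "subspace linfty"
proof (rule subspaceI)
  show "0 \<in> linfty"
    by (auto simp: linfty_def zero_fun_def bounded_iff)
qed (unfold linfty_def mem_Collect_eq, rule bounded_image_add bounded_image_scaleR, assumption+,
    rule bounded_image_scaleR)

end

theory Submission
  imports Defs
begin

text \<open>An infinite \<open>\<sigma>\<close>-algebra has a strictly decreasing sequence of members: if infinitely many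
  members lie below \<open>B\<close> and \<open>C \<subset> B\<close> is a nonempty member, then infinitely many lie below \<open>C\<close> or
  below \<open>B - C\<close>. Recording where a point drops out of such a sequence gives a measurable map
  \<open>N\<close> of \<open>X\<close> onto the natural numbers, and \<open>x \<mapsto> x \<circ> N\<close> is a linear isometry of \<open>\<ell>\<^sup>\<infinity>\<close> onto
  the functions that are constant on the fibres of \<open>N\<close>, which is a closed condition.\<close>

lemma (in algebra) infinite_trace_shrinks:
  assumes B: "B \<in> M" and inf: "infinite {D \<in> M. D \<subseteq> B}"
  shows "\<exists>C\<in>M. infinite {D \<in> M. D \<subseteq> C} \<and> C \<subset> B"
proof -
  \<comment> \<open>An infinite family has members besides \<open>{}\<close> and \<open>B\<close>.
    For such a \<open>C\<close>, \<open>C \<noteq> B\<close> makes \<open>C\<close> a proper subset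
    of \<open>B\<close>, and \<open>C \<noteq> {}\<close> does the same for
    \<open>B - C\<close>.\<close>
  have "\<not> {D \<in> M. D \<subseteq> B} \<subseteq> {{}, B}"
    using inf finite_subset by blast
  then obtain C where C: "C \<in> M" "C \<subseteq> B" "C \<noteq> {}" "C \<noteq> B"
    by blast
  \<comment> \<open>Each \<open>D\<close> is recovered from its traces \<open>D \<inter> C\<close>
    and \<open>D - C\<close>, so two finite families of traces would leave only finitely many
    \<open>D\<close>.\<close>
  have "{D \<in> M. D \<subseteq> B} \<subseteq> (\<lambda>(P, Q). P \<union> Q) ` ({D \<in> M. D \<subseteq> C} \<times> {D \<in> M. D \<subseteq> B - C})"
  proof
    fix D assume D: "D \<in> {D \<in> M. D \<subseteq> B}"
    then have "D = (\<lambda>(P, Q). P \<union> Q) (D \<inter> C, D - C)"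
      by auto
    moreover have "(D \<inter> C, D - C) \<in> {D \<in> M. D \<subseteq> C} \<times> {D \<in> M. D \<subseteq> B - C}"
      using C D by auto
    ultimately show "D \<in> (\<lambda>(P, Q). P \<union> Q) ` ({D \<in> M. D \<subseteq> C} \<times> {D \<in> M. D \<subseteq> B - C})"
      by (rule image_eqI)
  qed
  then have "infinite {D \<in> M. D \<subseteq> C} \<or> infinite {D \<in> M. D \<subseteq> B - C}"
    using inf by (meson finite_SigmaI finite_imageI finite_subset)
  then show ?thesis
  proof
    assume "infinite {D \<in> M. D \<subseteq> C}"
    with C show ?thesis by (intro bexI[of _ C]) auto
  next
    assume "infinite {D \<in> M. D \<subseteq> B - C}"
    with B C show ?thesis by (intro bexI[of _ "B - C"]) auto
  qed
qed

text \<open>Strict decrease alone could get stuck, for instance at \<open>{}\<close>. Dependent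
  choice therefore carries the invariant that infinitely many members lie below \<open>B n\<close>,
  and \<open>infinite_trace_shrinks\<close> supplies the next set.\<close>

lemma (in algebra) ex_strictly_decreasing_sequence:
  assumes "infinite M"
  shows "\<exists>B :: nat \<Rightarrow> 'a set. range B \<subseteq> M \<and> (\<forall>n. B (Suc n) \<subset> B n)"
proof -
  have "{D \<in> M. D \<subseteq> \<Omega>} = M"
    using space_closed by auto
  have "\<exists>B. \<forall>n. (B n \<in> M \<and> infinite {D \<in> M. D \<subseteq> B n}) \<and> B (Suc n) \<subset> B n"
  proof (intro dependent_nat_choice)
    show "\<exists>B. B \<in> M \<and> infinite {D \<in> M. D \<subseteq> B}"
      using assms \<open>{D \<in> M. D \<subseteq> \<Omega>} = M\<close> by (intro exI[of _ \<Omega>]) simp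
    show "\<exists>C. (C \<in> M \<and> infinite {D \<in> M. D \<subseteq> C}) \<and> C \<subset> B"
      if "B \<in> M \<and> infinite {D \<in> M. D \<subseteq> B}" for B
      using infinite_trace_shrinks[of B] that by blast
  qed
  then obtain B where B: "\<forall>n. (B n \<in> M \<and> infinite {D \<in> M. D \<subseteq> B n}) \<and> B (Suc n) \<subset> B n" ..
  then show ?thesis
    by (intro exI[of _ B] conjI allI image_subsetI) simp_all
qed

lemma ex_measurable_onto_nat:
  assumes "sigma_algebra X \<A>" "infinite \<A>"
  shows "\<exists>N \<in> sigma X \<A> \<rightarrow>\<^sub>M count_space UNIV. N ` X = (UNIV :: nat set)"
proof -
  interpret sigma_algebra X \<A> by fact
  obtain B :: "nat \<Rightarrow> 'a set" where B: "range B \<subseteq> \<A>" "\<And>n. B (Suc n) \<subset> B n"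
    using ex_strictly_decreasing_sequence[OF assms(2)] by blast
  \<comment> \<open>With the shift by \<open>Suc\<close>, points of \<open>B n - B (Suc n)\<close>
    get the value \<open>n\<close> and points outside \<open>B 0\<close> get \<open>0\<close>. For
    points in every \<open>B n\<close> the \<open>LEAST\<close> is unspecified, but it is the same
    number for all of them, so measurability survives.\<close>
  define N where "N y = (LEAST n. y \<notin> B (Suc n))" for y
  have [measurable]: "B n \<in> sets (sigma X \<A>)" for n
    using B(1) space_closed by (auto simp: sets_measure_of_eq)
  have "N \<in> sigma X \<A> \<rightarrow>\<^sub>M count_space UNIV"
    unfolding N_def by measurable
  moreover have "n \<in> N ` X" for n
  proof -
    obtain y where y: "y \<in> B n" "y \<notin> B (Suc n)"
      using B(2)[of n] by blast
    have B_mono: "B n \<subseteq> B (Suc m)" if "m < n" for m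
      using lift_Suc_antimono_le[of B "Suc m" n, OF psubset_imp_subset[OF B(2)]] that by simp
    have "n \<le> m" if "y \<notin> B (Suc m)" for m
      using B_mono[of m] y(1) that not_le by blast
    with y(2) have "N y = n"
      unfolding N_def by (intro Least_equality)
    moreover have "y \<in> X"
      using y(1) B(1) space_closed by blast
    ultimately show ?thesis by blast
  qed
  ultimately show ?thesis by blast
qed

theorem theorem3p8:
  fixes X :: "'a set" and \<A> :: "'a set set"
  assumes "sigma_algebra X \<A>" and "X \<noteq> {}" and "infinite \<A>"
  shows "\<exists>S T. S \<subseteq> bounded_measurable X \<A> \<and> subspace S
            \<and> closedin (bounded_measurable_topology X \<A>) S
            \<and> linear_map_on linfty T
            \<and> homeomorphic_map linfty_topology (subtopology (bounded_measurable_topology X \<A>) S) T"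
proof -
  interpret A: sigma_algebra X \<A> by fact
  interpret BM: Metric_space "bounded_measurable X \<A>" "sup_dist X"
    by (rule Metric_space_bounded_measurable) fact
  interpret Metric_space12 linfty "sup_dist UNIV" "bounded_measurable X \<A>" "sup_dist X"
    by (simp add: Metric_space12_def Metric_space_linfty BM.Metric_space_axioms)
  obtain N :: "'a \<Rightarrow> nat"
    where N[measurable]: "N \<in> sigma X \<A> \<rightarrow>\<^sub>M count_space UNIV" and onto: "N ` X = UNIV"
    using ex_measurable_onto_nat[OF assms(1,3)] by blast
  define T :: "(nat \<Rightarrow> real) \<Rightarrow> 'a \<Rightarrow> real" where "T x = (\<lambda>y. if y \<in> X then x (N y) else 0)" for x
  \<comment> \<open>A pointwise condition, instead of the image of \<open>T\<close>, gives
    closedness directly; \<open>S_eq\<close> identifies the two below.\<close>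
  define S where "S = {f \<in> bounded_measurable X \<A>. \<forall>y\<in>X. \<forall>z\<in>X. N y = N z \<longrightarrow> f y = f z}"
  have S_sub: "S \<subseteq> bounded_measurable X \<A>"
    and S_eqD: "\<And>f y z. \<lbrakk>f \<in> S; y \<in> X; z \<in> X; N y = N z\<rbrakk> \<Longrightarrow> f y = f z"
    unfolding S_def by blast+
  \<comment> \<open>Since \<open>N\<close> is onto, \<open>T x\<close> on \<open>X\<close> takes
    exactly the values of \<open>x\<close>; boundedness and the supremum norm depend on these values
    only.\<close>
  have T_image: "T x ` X = range x" for x
    unfolding onto[symmetric] by (force simp: T_def)
  have space: "space (sigma X \<A>) = X"
    by (rule space_measure_of) (rule A.space_closed)
  have T_S: "T x \<in> S" if "x \<in> linfty" for x
  proof -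
    have "(\<lambda>y. x (N y)) \<in> borel_measurable (sigma X \<A>)"
      by measurable
    then have "T x \<in> borel_measurable (sigma X \<A>)"
      by (subst measurable_cong[where g = "\<lambda>y. x (N y)"]) (auto simp: T_def space)
    then show ?thesis
      using that T_image[of x] by (auto simp: S_def bounded_measurable_def linfty_def T_def)
  qed
  have "f \<in> T ` linfty" if f: "f \<in> S" for f
  proof
    \<comment> \<open>The preimage of \<open>f\<close> under \<open>T\<close>: sample
      \<open>f\<close> at one chosen point of each fibre of \<open>N\<close>, where it is
      constant.\<close>
    define x where "x n = f (inv_into X N n)" for n
    have inv: "inv_into X N n \<in> X" "N (inv_into X N n) = n" for n
      using onto by (auto intro: inv_into_into f_inv_into_f)
    have "range x \<subseteq> f ` X"
      using inv by (auto simp: x_def)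
    moreover have "bounded (f ` X)"
      using f S_sub by (auto simp: bounded_measurable_def)
    ultimately show "x \<in> linfty"
      unfolding linfty_def by (blast intro: bounded_subset)
    show "f = T x"
    proof
      fix y
      show "f y = T x y"
      proof (cases "y \<in> X")
        case True
        then have "f (inv_into X N (N y)) = f y"
          using f inv[of "N y"] by (intro S_eqD)
        with True show ?thesis
          by (simp add: T_def x_def)
      qed (use f S_sub in \<open>auto simp: T_def bounded_measurable_def\<close>)
    qed
  qed
  with T_S have S_eq: "S = T ` linfty"
    by blast
  have linear: "linear_map_on linfty T"
    by (auto simp: linear_map_on_def T_def scaleR_fun_def fun_eq_iff)
  \<comment> \<open>This also holds for unbounded differences: both sides then take the default
    value 0 together.\<close>
  have isometry: "sup_dist X (T u) (T v) = sup_dist UNIV u v" for u v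
  proof -
    have "T u - T v = T (u - v)"
      by (auto simp: T_def fun_eq_iff)
    moreover have "sup_norm X (T x) = sup_norm UNIV x" for x
      using arg_cong[OF T_image[of x], of "\<lambda>A. Sup (abs ` A)"]
      by (simp add: sup_norm_def image_image)
    ultimately show ?thesis
      by (simp add: sup_dist_def T_image)
  qed
  have "subspace S"
  proof (rule subspaceI)
    show "0 \<in> S"
      using subspace_0[OF subspace_bounded_measurable] by (simp add: S_def)
  next
    fix f g assume fg: "f \<in> S" "g \<in> S"
    then have "f + g \<in> bounded_measurable X \<A>"
      using S_sub by (blast intro: subspace_add subspace_bounded_measurable)
    moreover have "(f + g) y = (f + g) z" if "y \<in> X" "z \<in> X" "N y = N z" for y z
      using S_eqD[OF fg(1) that] S_eqD[OF fg(2) that] by simp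
    ultimately show "f + g \<in> S"
      unfolding S_def by blast
  next
    fix c f assume f: "f \<in> S"
    then have "c *\<^sub>R f \<in> bounded_measurable X \<A>"
      using S_sub by (blast intro: subspace_scale subspace_bounded_measurable)
    moreover have "(c *\<^sub>R f) y = (c *\<^sub>R f) z" if "y \<in> X" "z \<in> X" "N y = N z" for y z
      using S_eqD[OF f that] by (simp add: scaleR_fun_def)
    ultimately show "c *\<^sub>R f \<in> S"
      unfolding S_def by blast
  qed
  moreover have "closedin (bounded_measurable_topology X \<A>) S"
    unfolding bounded_measurable_topology_def BM.closedin_metric
  proof (intro conjI allI impI)
    show "S \<subseteq> bounded_measurable X \<A>"
      by (rule S_sub)
    fix f assume "f \<in> bounded_measurable X \<A> - S"
    then obtain y z where f: "f \<in> bounded_measurable X \<A>"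
      and yz: "y \<in> X" "z \<in> X" "N y = N z" "f y \<noteq> f z"
      unfolding S_def by blast
    \<comment> \<open>A \<open>g\<close> in \<open>S\<close> has \<open>g y = g z\<close>, so
      \<open>\<bar>f y - f z\<bar> \<le> \<bar>f y - g y\<bar> + \<bar>f z - g z\<bar>\<close>.
      Within half the gap of \<open>f\<close>, the right-hand side would be smaller than the
      gap.\<close>
    have "g \<notin> BM.mball f (\<bar>f y - f z\<bar> / 2)" if g: "g \<in> S" for g
    proof
      assume gb: "g \<in> BM.mball f (\<bar>f y - f z\<bar> / 2)"
      have b: "bounded ((f - g) ` X)"
        using f g S_sub by (intro bounded_image_diff) (auto simp: bounded_measurable_def)
      have "g y = g z"
        using g yz by (intro S_eqD)
      then show False
        using gb b abs_le_sup_norm[OF b yz(1)] abs_le_sup_norm[OF b yz(2)]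
        by (auto simp: sup_dist_def)
    qed
    then show "\<exists>r>0. disjnt S (BM.mball f r)"
      using yz(4) by (intro exI[of _ "\<bar>f y - f z\<bar> / 2"]) (auto simp: disjnt_iff)
  qed
  moreover have "homeomorphic_map linfty_topology
      (subtopology (bounded_measurable_topology X \<A>) S) T"
  proof -
    \<comment> \<open>An isometry is a homeomorphism onto its image, and that image is
      \<open>S\<close>.\<close>
    have "embedding_map linfty_topology (bounded_measurable_topology X \<A>) T"
      unfolding linfty_topology_def bounded_measurable_topology_def
      using T_S S_sub isometry by (intro isometry_imp_embedding_map) auto
    then show ?thesis
      by (simp add: embedding_map_def topspace_linfty_topology S_eq)
  qed
  ultimately show ?thesis
    using linear S_sub by (intro exI[of _ S] exI[of _ T] conjI)
qed

end
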